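(* Let $\mathbf{F}$ be a Bateman field of Hopf type and let $L\subset\mathbb{R}^3$ be a link formed by closed field lines of its magnetic (or of its electric) part at time $t=0$. Let $\Phi_t$, $t\in\mathbb{R}$, be the smooth family of diffeomorphisms of $\mathbb{R}^3$ describing the time evolution of field lines of Bateman fields of Hopf type, so that $\Phi_t(L)$ is a set of closed field lines at time $t$. Then for every compact set $K\subset\mathbb{R}^3$ the set $$\{t\in\mathbb{R}:\Phi_t(L)\cap K\neq\emptyset\}$$ is bounded.
   Context: Define $\alpha,\beta:\mathbb{R}^{3+1}\to\mathbb{C}$ (spatial coordinates $x,y,z$, time $t$) by $$\alpha=\frac{x^2+y^2+z^2-t^2-1+2\mathrm{i}z}{x^2+y^2+z^2-(t-\mathrm{i})^2},\qquad \beta=\frac{2(x-\mathrm{i}y)}{x^2+y^2+z^2-(t-\mathrm{i})^2}.$$ For every fixed $t$, $(\alpha,\beta)|_t$ takes values in the unit sphere $S^3\subset\mathbb{C}^2$ and extends to a diffeomorphism $\mathbb{R}^3\cup\{\infty\}\to S^3$ with $\infty\mapsto(1,0)$; denote its inverse by $\varphi_t:S^3\to\mathbb{R}^3\cup\{\infty\}$. The family of diffeomorphisms is $\Phi_t=\varphi_t\circ\varphi_0^{-1}:\mathbb{R}^3\to\mathbb{R}^3$, with $\Phi_0=\mathrm{id}$. A Bateman field of Hopf type is $\mathbf{F}=h(\alpha,\beta)\,\nabla\alpha\times\nabla\beta$, where $h$ is holomorphic on a neighbourhood in $\mathbb{C}^2$ of the image of $(\alpha,\beta)$ and $\nabla$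 is the gradient in $x,y,z$. Writing $\mathbf{F}=\mathbf{E}_t+\mathrm{i}\mathbf{B}_t$ with real time-dependent vector fields on $\mathbb{R}^3$, $\mathbf{E}_t$ is the electric part and $\mathbf{B}_t$ the magnetic part. A closed field line at time $t$ is a (non-constant) periodic orbit of $\mathbf{E}_t$, respectively $\mathbf{B}_t$. A link is a finite disjoint union of smoothly embedded circles. *)

theory Defs
  imports "HOL-Analysis.Analysis"
begin

text \<open>
  A point \<open>p :: real^3\<close> has spatial coordinates \<open>x = p$1\<close>, \<open>y = p$2\<close>, \<open>z = p$3\<close>; the time
  \<open>t\<close> is a separate argument, so that \<open>\<alpha> t\<close> is the restriction of \<open>\<alpha>\<close> to a time slice.
\<close>

definition denom :: "real \<Rightarrow> real^3 \<Rightarrow> complex" where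
  "denom t p = of_real ((p$1)^2 + (p$2)^2 + (p$3)^2) - (of_real t - \<i>)^2"

definition \<alpha> :: "real \<Rightarrow> real^3 \<Rightarrow> complex" where
  "\<alpha> t p = (of_real ((p$1)^2 + (p$2)^2 + (p$3)^2 - t^2 - 1) + 2 * \<i> * of_real (p$3)) / denom t p"

definition \<beta> :: "real \<Rightarrow> real^3 \<Rightarrow> complex" where
  "\<beta> t p = 2 * (of_real (p$1) - \<i> * of_real (p$2)) / denom t p"

text \<open>
  \<open>\<real>\<^sup>3 \<union> {\<infinity>}\<close> is \<open>(real^3) option\<close> with \<open>None\<close> as \<open>\<infinity>\<close>. The unit sphere \<open>S\<^sup>3\<close> is
  \<open>sphere 0 1\<close> in \<open>complex \<times> complex\<close>, whose product norm is the Hermitian one.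
\<close>

fun hopf_map :: "real \<Rightarrow> (real^3) option \<Rightarrow> complex \<times> complex" where
  "hopf_map t (Some p) = (\<alpha> t p, \<beta> t p)"
| "hopf_map t None = (1, 0)"

definition \<phi> :: "real \<Rightarrow> complex \<times> complex \<Rightarrow> (real^3) option" where
  "\<phi> t = inv_into UNIV (hopf_map t)"

text \<open>
  \<open>\<phi>\<^sub>t \<circ> \<phi>\<^sub>0\<^sup>-\<^sup>1\<close> restricted to \<open>\<real>\<^sup>3\<close>; it does not hit \<open>\<infinity>\<close> there, see
  \<open>Some_\<Phi>\<close> below.
\<close>

definition \<Phi> :: "real \<Rightarrow> real^3 \<Rightarrow> real^3" where
  "\<Phi> t p = the (\<phi> t (hopf_map 0 (Some p)))"

definition grad :: "(real^3 \<Rightarrow> complex) \<Rightarrow> real^3 \<Rightarrow> complex^3" where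
  "grad f p = (\<chi> i. frechet_derivative f (at p) (axis i 1))"

text \<open>The bilinear (not sesquilinear) cross product on \<open>\<complex>\<^sup>3\<close>; \<open>cross3\<close> is only for \<open>real^3\<close>.\<close>

definition ccross :: "complex^3 \<Rightarrow> complex^3 \<Rightarrow> complex^3" where
  "ccross a b = vector [a$2 * b$3 - a$3 * b$2, a$3 * b$1 - a$1 * b$3, a$1 * b$2 - a$2 * b$1]"

text \<open>Holomorphy in two variables on an open set: the total derivative exists and is \<open>\<complex>\<close>-linear.\<close>

definition holomorphic2_on :: "(complex \<times> complex \<Rightarrow> complex) \<Rightarrow> (complex \<times> complex) set \<Rightarrow> bool" where
  "holomorphic2_on h U \<longleftrightarrow>
     (\<forall>w\<in>U. \<exists>a b. (h has_derivative (\<lambda>(u, v). a * u + b * v)) (at w))"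

definition bateman_hopf_field :: "(real \<Rightarrow> real^3 \<Rightarrow> complex^3) \<Rightarrow> bool" where
  "bateman_hopf_field F \<longleftrightarrow>
     (\<exists>h U. open U \<and> (\<forall>t p. (\<alpha> t p, \<beta> t p) \<in> U) \<and> holomorphic2_on h U \<and>
        (\<forall>t p. F t p = h (\<alpha> t p, \<beta> t p) *s ccross (grad (\<alpha> t) p) (grad (\<beta> t) p)))"

definition electric :: "(real \<Rightarrow> real^3 \<Rightarrow> complex^3) \<Rightarrow> real \<Rightarrow> real^3 \<Rightarrow> real^3" where
  "electric F t p = (\<chi> i. Re (F t p $ i))"

definition magnetic :: "(real \<Rightarrow> real^3 \<Rightarrow> complex^3) \<Rightarrow> real \<Rightarrow> real^3 \<Rightarrow> real^3" where
  "magnetic F t p = (\<chi> i. Im (F t p $ i))"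

definition closed_field_line :: "(real^3 \<Rightarrow> real^3) \<Rightarrow> (real^3) set \<Rightarrow> bool" where
  "closed_field_line V C \<longleftrightarrow>
     (\<exists>\<gamma> T. T > 0 \<and> (\<forall>s. (\<gamma> has_vector_derivative V (\<gamma> s)) (at s)) \<and>
        (\<forall>s. \<gamma> (s + T) = \<gamma> s) \<and> \<not> \<gamma> constant_on UNIV \<and> C = range \<gamma>)"

text \<open>\<open>D n\<close> is the \<open>n\<close>-th derivative of the curve.\<close>

definition smooth_curve :: "(real \<Rightarrow> real^3) \<Rightarrow> bool" where
  "smooth_curve \<gamma> \<longleftrightarrow>
     (\<exists>D. D 0 = \<gamma> \<and> (\<forall>n s. (D n has_vector_derivative D (Suc n) s) (at s)))"

text \<open>A smooth embedding of the circle \<open>\<real>/\<int>\<close>, written as a curve on \<open>\<real>\<close>.\<close>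

definition smoothly_embedded_circle :: "(real^3) set \<Rightarrow> bool" where
  "smoothly_embedded_circle C \<longleftrightarrow>
     (\<exists>\<gamma>. smooth_curve \<gamma> \<and> (\<forall>s. vector_derivative \<gamma> (at s) \<noteq> 0) \<and>
        (\<forall>s s'. \<gamma> s = \<gamma> s' \<longleftrightarrow> s - s' \<in> \<int>) \<and> C = range \<gamma>)"

definition is_link :: "(real^3) set \<Rightarrow> bool" where
  "is_link L \<longleftrightarrow>
     (\<exists>\<C>. finite \<C> \<and> disjoint \<C> \<and> (\<forall>C\<in>\<C>. smoothly_embedded_circle C) \<and> L = \<Union>\<C>)"

text \<open>
  The circles of a link are its connected components, since they are compact, connected,
  pairwise disjoint and finitely many.
\<close>

definition formed_by_closed_field_lines :: "(real^3) set \<Rightarrow> (real^3 \<Rightarrow> real^3) \<Rightarrow> bool" where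
  "formed_by_closed_field_lines L V \<longleftrightarrow> (\<forall>C\<in>components L. closed_field_line V C)"

subsection \<open>\<open>\<phi>\<close> and \<open>\<Phi>\<close> are well defined\<close>

lemma denom_eq:
  "denom t p = Complex ((p$1)^2 + (p$2)^2 + (p$3)^2 - t^2 + 1) (2 * t)"
  by (simp add: denom_def complex_eq_iff power2_eq_square algebra_simps)

lemma denom_nonzero: "denom t p \<noteq> 0"
proof
  assume "denom t p = 0"
  then have "t = 0" "(p$1)^2 + (p$2)^2 + (p$3)^2 + 1 = 0"
    by (auto simp: denom_eq complex_eq_iff)
  moreover have "(p$1)^2 + (p$2)^2 + (p$3)^2 \<ge> 0" by simp
  ultimately show False by linarith
qed

lemma \<alpha>_times_denom:
  "\<alpha> t p * denom t p = Complex ((p$1)^2 + (p$2)^2 + (p$3)^2 - t^2 - 1) (2 * p$3)"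
  using denom_nonzero[of t p] by (simp add: \<alpha>_def complex_eq_iff)

lemma \<beta>_times_denom: "\<beta> t p * denom t p = Complex (2 * p$1) (- 2 * p$2)"
  using denom_nonzero[of t p] by (simp add: \<beta>_def complex_eq_iff)

lemma one_minus_\<alpha>_times_denom: "(1 - \<alpha> t p) * denom t p = Complex 2 (2 * (t - p$3))"
  unfolding left_diff_distrib \<alpha>_times_denom by (simp add: denom_eq complex_eq_iff)

lemma mem_S3_iff: "(u, v) \<in> sphere 0 1 \<longleftrightarrow> (cmod u)^2 + (cmod v)^2 = 1"
  by (simp add: norm_Pair)

lemma \<alpha>_\<beta>_in_S3: "(cmod (\<alpha> t p))^2 + (cmod (\<beta> t p))^2 = 1"
proof -
  have "((cmod (\<alpha> t p))^2 + (cmod (\<beta> t p))^2) * (cmod (denom t p))^2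
      = (cmod (\<alpha> t p * denom t p))^2 + (cmod (\<beta> t p * denom t p))^2"
    by (simp add: norm_mult power_mult_distrib algebra_simps)
  also have "\<dots> = (cmod (denom t p))^2"
    unfolding \<alpha>_times_denom \<beta>_times_denom
    by (simp add: denom_eq cmod_power2) algebra
  finally show ?thesis using denom_nonzero[of t p] by simp
qed

lemma \<alpha>_neq_1: "\<alpha> t p \<noteq> 1"
  using one_minus_\<alpha>_times_denom[of t p] by (auto simp: complex_eq_iff)

lemma Re_less_1: "Re u < 1" if "(cmod u)^2 \<le> 1" "u \<noteq> 1"
proof (rule ccontr)
  assume "\<not> Re u < 1"
  then have "1 \<le> (Re u)^2" by simp
  with that(1) have "(Re u)^2 = 1" "(Im u)^2 \<le> 0"
    unfolding cmod_power2 using zero_le_power2[of "Im u"] by linarith+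
  with \<open>\<not> Re u < 1\<close> have "Re u = 1" "Im u = 0" by (auto simp: power2_eq_1_iff)
  with that(2) show False by (simp add: complex_eq_iff)
qed

lemma bij_betw_hopf_map: "bij_betw (hopf_map t) UNIV (sphere 0 1)"
  unfolding bij_betw_def
proof (intro conjI equalityI subsetI)
  have eq: "p = q" if "\<alpha> t p = \<alpha> t q" "\<beta> t p = \<beta> t q" for p q :: "real^3"
  proof -
    have a: "Re (\<alpha> t p) < 1"
      using \<alpha>_\<beta>_in_S3[of t p] \<alpha>_neq_1[of t p] zero_le_power2[of "cmod (\<beta> t p)"]
      by (intro Re_less_1) linarith+
    define d where "d = Re (denom t p) - Re (denom t q)"
    have d: "denom t p - denom t q = of_real d"
      by (simp add: d_def denom_eq complex_eq_iff)
    have "(1 - \<alpha> t p) * (denom t p - denom t q) = Complex 0 (2 * (q$3 - p$3))"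
      unfolding right_diff_distrib one_minus_\<alpha>_times_denom
      unfolding that(1) one_minus_\<alpha>_times_denom by (simp add: complex_eq_iff)
    then have "(1 - Re (\<alpha> t p)) * d = 0" and z: "- Im (\<alpha> t p) * d = 2 * (q$3 - p$3)"
      unfolding d by (simp_all add: complex_eq_iff)
    with a have "d = 0" by simp
    with d z have D: "denom t p = denom t q" and 3: "p$3 = q$3" by auto
    have "Complex (2 * p$1) (- 2 * p$2) = Complex (2 * q$1) (- 2 * q$2)"
      using \<beta>_times_denom[of t p] \<beta>_times_denom[of t q] that(2) D by metis
    with 3 show ?thesis by (simp add: vec_eq_iff forall_3)
  qed
  show "inj (hopf_map t)"
  proof (rule injI)
    fix a b assume "hopf_map t a = hopf_map t b"
    then show "a = b"
      using \<alpha>_neq_1[of t] \<alpha>_neq_1[of t, symmetric] eq by (cases a; cases b; simp)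
  qed
next
  fix w assume "w \<in> range (hopf_map t)"
  then obtain a where "w = hopf_map t a" by auto
  then show "w \<in> sphere 0 1"
    using \<alpha>_\<beta>_in_S3 by (cases a) (auto simp: norm_Pair)
next
  fix w :: "complex \<times> complex" assume w: "w \<in> sphere 0 1"
  obtain u v where uv: "w = (u, v)" by force
  have n: "(cmod u)^2 + (cmod v)^2 = 1" using w unfolding uv mem_S3_iff .
  show "w \<in> range (hopf_map t)"
  proof (cases "u = 1")
    case True
    with n have "w = hopf_map t None" by (simp add: uv)
    then show ?thesis by blast
  next
    case False
    have "(cmod u)^2 \<le> 1" using n zero_le_power2[of "cmod v"] by linarith
    then have "Re u < 1" using False by (rule Re_less_1)
    define a b where "a = 1 - Re u" and "b = - Im u"
    have "a > 0" using \<open>Re u < 1\<close> by (simp add: a_def)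
    define S where "S = (2 + 2 * t * b) / a"
    define z where "z = t - (S * b + 2 * t * a) / 2"
    define c where "c = v * Complex S (2 * t)"
    define p :: "real^3" where "p = vector [Re c / 2, - Im c / 2, z]"
    have p: "p$1 = Re c / 2" "p$2 = - Im c / 2" "p$3 = z"
      by (simp_all add: p_def vector_3)
    have aS: "a * S = 2 + 2 * t * b" using \<open>a > 0\<close> by (simp add: S_def)
    have v: "(cmod v)^2 = 2 * a - a^2 - b^2"
      using n unfolding cmod_power2[of u] a_def b_def
      by (simp add: power2_eq_square algebra_simps)
    have "(p$1)^2 + (p$2)^2 = (cmod c)^2 / 4"
      by (simp add: p cmod_power2 power_divide)
    also have "\<dots> = (2 * a - a^2 - b^2) * (S^2 + 4 * t^2) / 4"
      unfolding c_def by (simp add: norm_mult power_mult_distrib v) (simp add: cmod_power2)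
    finally have xy: "4 * ((p$1)^2 + (p$2)^2) = (2 * a - a^2 - b^2) * (S^2 + 4 * t^2)" by simp
    have z2: "2 * z = 2 * t - S * b - 2 * t * a" by (simp add: z_def field_simps)
    have "4 * ((p$1)^2 + (p$2)^2 + (p$3)^2) = 4 * (S - 1 + t^2)"
      using xy z2 aS p(3) by algebra
    then have "(p$1)^2 + (p$2)^2 + (p$3)^2 = S - 1 + t^2" by simp
    then have D: "denom t p = Complex S (2 * t)" by (simp add: denom_eq)
    have "(1 - \<alpha> t p) * denom t p = (1 - u) * denom t p"
      unfolding one_minus_\<alpha>_times_denom unfolding D p z_def
      using aS by (simp add: complex_eq_iff a_def b_def field_simps)
    then have "\<alpha> t p = u" using denom_nonzero[of t p] by simp
    moreover have "\<beta> t p * denom t p = v * denom t p"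
      unfolding \<beta>_times_denom unfolding D p c_def[symmetric] by (simp add: complex_eq_iff)
    then have "\<beta> t p = v" using denom_nonzero[of t p] by simp
    ultimately have "w = hopf_map t (Some p)" by (simp add: uv)
    then show ?thesis by blast
  qed
qed

lemma Some_\<Phi>: "Some (\<Phi> t p) = \<phi> t (hopf_map 0 (Some p))"
proof -
  have "hopf_map 0 (Some p) \<in> range (hopf_map t)"
    using bij_betw_imp_surj_on[OF bij_betw_hopf_map[of 0]]
      bij_betw_imp_surj_on[OF bij_betw_hopf_map[of t]] by (metis rangeI)
  then have "hopf_map t (\<phi> t (hopf_map 0 (Some p))) = hopf_map 0 (Some p)"
    unfolding \<phi>_def by (rule f_inv_into_f)
  then have "\<phi> t (hopf_map 0 (Some p)) \<noteq> None"
    using \<alpha>_neq_1[of 0 p] by (metis hopf_map.simps prod.inject)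
  then show ?thesis by (simp add: \<Phi>_def)
qed

lemma \<Phi>_0: "\<Phi> 0 = id"
proof
  fix p
  have "Some (\<Phi> 0 p) = Some p"
    unfolding Some_\<Phi> \<phi>_def
    by (rule inv_into_f_f[OF bij_betw_imp_inj_on[OF bij_betw_hopf_map] UNIV_I])
  then show "\<Phi> 0 p = id p" by simp
qed

end

theory Submission
  imports Defs
begin

text \<open>
  Field lines of Bateman fields of Hopf type escape at the speed of light. The point
  \<open>q = \<Phi> t p\<close> is characterised by \<open>(\<alpha>, \<beta>)\<close> having the same value at \<open>q\<close> at time \<open>t\<close> as at \<open>p\<close>
  at time \<open>0\<close>. Of this, the equality of the \<open>\<alpha>\<close>-values alone already fixes the distance of \<open>q\<close>
  from the origin: \<open>1 - \<alpha>\<close> is a quotient with a numerator affine in \<open>z\<close> and \<open>t\<close>, and the real part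
  of the cross-multiplied equation is \<open>|q|\<^sup>2 = |p|\<^sup>2 - 2 t z + t\<^sup>2\<close>, where \<open>z\<close> is the third
  coordinate of \<open>p\<close>. The right-hand side is \<open>|p - t e|\<^sup>2\<close> with \<open>e\<close> the unit vector in the
  \<open>z\<close>-direction (lemma \<open>norm_\<Phi>\<close>), so \<open>\<Phi> t p\<close> has distance at least \<open>|t| - |p|\<close> from the origin.

  A link is bounded, being a finite union of continuous images of a period interval. Therefore
  the estimate is uniform over its points, and the whole link leaves any bounded set once \<open>|t|\<close>
  is large.
\<close>

lemma hopf_map_\<Phi>: "hopf_map t (Some (\<Phi> t p)) = hopf_map 0 (Some p)"
  unfolding Some_\<Phi> \<phi>_def
  using bij_betw_imp_surj_on[OF bij_betw_hopf_map[of 0]]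
    bij_betw_imp_surj_on[OF bij_betw_hopf_map[of t]]
  by (metis f_inv_into_f rangeI)

lemma norm_vec3_squared: "(norm (p :: real^3))\<^sup>2 = (p$1)\<^sup>2 + (p$2)\<^sup>2 + (p$3)\<^sup>2"
  unfolding power2_norm_eq_inner by (simp add: inner_vec_def sum_3 power2_eq_square)

text \<open>
  The map \<open>\<Phi> t\<close> itself is not the translation by \<open>- t e\<close>, but it displaces points to the same
  distance from the origin.
\<close>

lemma norm_\<Phi>: "norm (\<Phi> t p) = norm (p - t *\<^sub>R axis 3 1)"
proof -
  define q where "q = \<Phi> t p"
  have "\<alpha> t q = \<alpha> 0 p"
    using hopf_map_\<Phi>[of t p] by (simp add: q_def)
  then have "((1 - \<alpha> t q) * denom t q) * denom 0 p = ((1 - \<alpha> 0 p) * denom 0 p) * denom t q"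
    by simp
  then have "Complex 2 (2 * (t - q$3)) * denom 0 p = Complex 2 (2 * (0 - p$3)) * denom t q"
    unfolding one_minus_\<alpha>_times_denom .
  \<comment> \<open>The imaginary part would determine \<open>q$3\<close>; the real part is free of it,
      because \<open>denom 0 p\<close> is real.\<close>
  then have "(norm q)\<^sup>2 = (norm p)\<^sup>2 - 2 * t * p$3 + t\<^sup>2"
    unfolding denom_eq norm_vec3_squared by (simp add: complex_eq_iff algebra_simps)
  also have "\<dots> = (norm (p - t *\<^sub>R axis 3 1))\<^sup>2"
    unfolding norm_vec3_squared by (simp add: axis_def power2_eq_square algebra_simps)
  finally show ?thesis
    by (simp add: q_def)
qed

lemma abs_time_le: "\<bar>t\<bar> \<le> norm (\<Phi> t p) + norm p"
proof -
  have "\<bar>t\<bar> = norm (t *\<^sub>R axis 3 (1::real) :: real^3)"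
    by simp
  also have "\<dots> \<le> norm (p - t *\<^sub>R axis 3 1) + norm p"
    by (metis add.commute norm_minus_commute norm_triangle_sub)
  finally show ?thesis
    by (simp add: norm_\<Phi>)
qed

lemma compact_smoothly_embedded_circle:
  assumes "smoothly_embedded_circle C"
  shows "compact C"
proof -
  obtain \<gamma> where smooth: "smooth_curve \<gamma>"
    and period: "\<And>s s'. \<gamma> s = \<gamma> s' \<longleftrightarrow> s - s' \<in> \<int>" and C: "C = range \<gamma>"
    using assms unfolding smoothly_embedded_circle_def by blast
  have "\<gamma> s = \<gamma> (frac s)" for s
    unfolding period by (simp add: frac_def)
  moreover have "frac s \<in> {0..1}" for s :: real
    using frac_lt_1[of s] by simp
  ultimately have "C = \<gamma> ` {0..1}"
    unfolding C by blast
  moreover have "continuous_on {0..1} \<gamma>"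
    using smooth unfolding smooth_curve_def
    by (metis continuous_at_imp_continuous_on has_vector_derivative_continuous)
  ultimately show ?thesis
    by (simp add: compact_continuous_image)
qed

lemma bounded_link: "is_link L \<Longrightarrow> bounded L"
  unfolding is_link_def
  by (metis bounded_Union compact_imp_bounded compact_smoothly_embedded_circle)

lemma bounded_times_meeting:
  assumes "bounded L" "bounded K"
  shows "bounded {t. \<Phi> t ` L \<inter> K \<noteq> {}}"
proof -
  obtain A B where "\<And>p. p \<in> L \<Longrightarrow> norm p \<le> A" "\<And>q. q \<in> K \<Longrightarrow> norm q \<le> B"
    using assms unfolding bounded_iff by blast
  then have "\<bar>t\<bar> \<le> B + A" if "p \<in> L" "\<Phi> t p \<in> K" for t p
    using that abs_time_le[of t p] by (meson add_mono order_trans)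
  then show ?thesis
    unfolding bounded_iff real_norm_def by blast
qed

theorem theorem1p8:
  fixes F :: "real \<Rightarrow> real^3 \<Rightarrow> complex^3" and L :: "(real^3) set"
  assumes "bateman_hopf_field F"
    and "is_link L"
    and "formed_by_closed_field_lines L (magnetic F 0) \<or> formed_by_closed_field_lines L (electric F 0)"
  shows "\<forall>K. compact K \<longrightarrow> bounded {t. \<Phi> t ` L \<inter> K \<noteq> {}}"
  using bounded_times_meeting[OF bounded_link[OF assms(2)]] compact_imp_bounded by blast

end
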